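(* There exists a recursive coloring function $c:\mathbb{N}\rightarrow \{0,1\}^3$ such that no infinite $\Delta^0_3$ set $A\subseteq\mathbb{N}$ is a solution to $c$ for $\mathrm{HT}^{\leq 3}$, i.e. for every infinite $\Delta^0_3$ set $A$, the set $FS^{\leq 3}(A)$ is not monochromatic under $c$.
   Context: For a set $H\subseteq\mathbb{N}$ and a natural number $k$, $FS^{\leq k}(H)=\{\sum_{x\in F}x : F\subseteq H,\ F\text{ nonempty},\ |F|\leq k\}$. A set $H$ is a solution to $c$ for $\mathrm{HT}^{\leq k}$ if $H$ is infinite and $FS^{\leq k}(H)$ is monochromatic under $c$. *)

theory Defs
  imports Main
begin

datatype recf = Zero | Succ | Proj nat | Comp recf "recf list" | Prim recf recf | Mn recf

inductive eval :: "recf \<Rightarrow> nat list \<Rightarrow> nat \<Rightarrow> bool" where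
  eval_Zero: "eval Zero xs 0"
| eval_Succ: "eval Succ (x # xs) (Suc x)"
| eval_Proj: "i < length xs \<Longrightarrow> eval (Proj i) xs (xs ! i)"
| eval_Comp: "list_all2 (\<lambda>g y. eval g xs y) gs ys \<Longrightarrow> eval f ys z \<Longrightarrow> eval (Comp f gs) xs z"
| eval_Prim0: "eval f xs z \<Longrightarrow> eval (Prim f g) (0 # xs) z"
| eval_PrimS: "eval (Prim f g) (n # xs) y \<Longrightarrow> eval g (y # n # xs) z \<Longrightarrow> eval (Prim f g) (Suc n # xs) z"
| eval_Mn: "eval f (n # xs) 0 \<Longrightarrow> (\<forall>m<n. \<exists>y. eval f (m # xs) y \<and> y > 0) \<Longrightarrow> eval (Mn f) xs n"

definition recursive_fun :: "(nat \<Rightarrow> nat) \<Rightarrow> bool" where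
  "recursive_fun f \<longleftrightarrow> (\<exists>t. \<forall>x. eval t [x] (f x))"

definition recursive_rel :: "nat \<Rightarrow> (nat list \<Rightarrow> bool) \<Rightarrow> bool" where
  "recursive_rel k P \<longleftrightarrow>
     (\<exists>t. \<forall>xs. length xs = k \<longrightarrow> eval t xs (if P xs then 1 else 0))"

definition Sigma03 :: "nat set \<Rightarrow> bool" where
  "Sigma03 A \<longleftrightarrow> (\<exists>R. recursive_rel 4 R \<and>
     (\<forall>x. x \<in> A \<longleftrightarrow> (\<exists>a. \<forall>b. \<exists>c. R [x, a, b, c])))"

definition Pi03 :: "nat set \<Rightarrow> bool" where
  "Pi03 A \<longleftrightarrow> (\<exists>R. recursive_rel 4 R \<and>
     (\<forall>x. x \<in> A \<longleftrightarrow> (\<forall>a. \<exists>b. \<forall>c. R [x, a, b, c])))"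

definition Delta03 :: "nat set \<Rightarrow> bool" where
  "Delta03 A \<longleftrightarrow> Sigma03 A \<and> Pi03 A"

definition code3 :: "bool \<times> bool \<times> bool \<Rightarrow> nat" where
  "code3 v = (case v of (a, b, d) \<Rightarrow> (if a then 4 else 0) + (if b then 2 else 0) + (if d then 1 else 0))"

definition recursive_coloring :: "(nat \<Rightarrow> bool \<times> bool \<times> bool) \<Rightarrow> bool" where
  "recursive_coloring c \<longleftrightarrow> recursive_fun (code3 \<circ> c)"

definition FS_le :: "nat \<Rightarrow> nat set \<Rightarrow> nat set" where
  "FS_le k H = {\<Sum>F | F. F \<subseteq> H \<and> F \<noteq> {} \<and> finite F \<and> card F \<le> k}"

definition monochromatic :: "('a \<Rightarrow> 'b) \<Rightarrow> 'a set \<Rightarrow> bool" where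
  "monochromatic c S \<longleftrightarrow> (\<exists>col. \<forall>s\<in>S. c s = col)"

definition HT_le_solution :: "nat \<Rightarrow> (nat \<Rightarrow> 'b) \<Rightarrow> nat set \<Rightarrow> bool" where
  "HT_le_solution k c H \<longleftrightarrow> infinite H \<and> monochromatic c (FS_le k H)"

end

theory Submission
  imports Defs "HOL-Library.Nat_Bijection"
begin

text \<open>
  The first bit of the color of \<open>n\<close> tells whether the lowest nonzero ternary digit of \<open>n\<close> is 1. It
  forces the elements of a monochromatic set \<open>A\<close> to have distinct lowest positions, so \<open>A\<close> contains
  \<open>x\<close>, \<open>y\<close>, \<open>z\<close> whose blocks of digits lie arbitrarily far apart.

  The last bit diagonalizes against all \<open>\<Sigma>\<^sub>3\<close> sets (the middle bit is constant). It is the parity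
  of a scan that cuts the digits of \<open>n\<close> into segments. Where to cut at position \<open>s\<close> is decided by
  claims: each of the first \<open>s\<close> indices \<open>e\<close> picks the least pair \<open>\<langle>x, a\<rangle>\<close> such that \<open>a\<close> has not been
  refuted up to \<open>s\<close> as a witness of \<open>x \<in> A\<^sub>e\<close> and such that the last segment of \<open>x\<close> is not claimed by a
  smaller index; it then requests a cut after \<open>x\<close>, with a label that makes the total parity of \<open>x\<close>
  odd. Refutations are recursive in the halting problem and are approximated in \<open>t\<close> steps, where \<open>t\<close>
  is the number of digits of \<open>n\<close>. If \<open>A = A\<^sub>e\<close> is infinite, then at every large stage \<open>s\<close> the index
  \<open>e\<close> picks some \<open>x \<in> A\<close>, because the smaller indices occupy only \<open>e\<close> segments; the \<open>x\<close> may
  depend on \<open>s\<close>. With \<open>y \<in> A\<close> starting at such an \<open>s\<close> and \<open>z \<in> A\<close> so far away that the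
  approximation is correct up to \<open>s\<close>, the scans of \<open>x + y + z\<close> and \<open>y + z\<close> agree from \<open>s\<close> on,
  except that the parities differ.
\<close>

section \<open>Recursive functions\<close>

lemma eval_Comp1: "eval g xs y \<Longrightarrow> eval f [y] z \<Longrightarrow> eval (Comp f [g]) xs z"
  by (rule eval_Comp[where ys = "[y]"]) auto

lemma eval_Comp2:
  "eval g xs y \<Longrightarrow> eval h xs y' \<Longrightarrow> eval f [y, y'] z \<Longrightarrow> eval (Comp f [g, h]) xs z"
  by (rule eval_Comp[where ys = "[y, y']"]) auto

lemma eval_Proj_nth: "i < length xs \<Longrightarrow> y = xs ! i \<Longrightarrow> eval (Proj i) xs y"
  by (simp add: eval_Proj)

lemma eval_Succ_1: "eval Succ [x] (Suc x)"
  by (rule eval_Succ)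

lemma eval_Prim_rec_nat:
  assumes "eval f xs a" "\<And>n y. eval g (y # n # xs) (h n y)"
  shows "eval (Prim f g) (n # xs) (rec_nat a h n)"
  by (induction n) (auto intro: assms eval_Prim0 eval_PrimS)

lemma eval_Mn_Least:
  assumes "\<And>n. eval f (n # xs) (F n)" "\<exists>n. F n = 0"
  shows "eval (Mn f) xs (LEAST n. F n = 0)"
proof (rule eval_Mn)
  show "eval f ((LEAST n. F n = 0) # xs) 0"
    using assms(1)[of "LEAST n. F n = 0"] LeastI_ex[OF assms(2)] by simp
  show "\<forall>m<LEAST n. F n = 0. \<exists>y. eval f (m # xs) y \<and> 0 < y"
    using assms(1) not_less_Least by blast
qed

text \<open>For a program that decides a relation, this makes "the output is 1" equivalent to "the
  relation holds".\<close>

lemma eval_deterministic: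
  assumes "eval f xs y" "eval f xs z"
  shows "y = z"
  using assms
proof (induction arbitrary: z rule: eval.induct)
  case (eval_Comp xs gs ys f y z)
  from eval_Comp.prems obtain zs where zs: "list_all2 (\<lambda>g. eval g xs) gs zs" "eval f zs z"
    by cases auto
  have "ys = zs"
    using eval_Comp.IH(1) zs(1) by (auto simp: list_all2_conv_all_nth intro!: nth_equalityI)
  then show ?case using eval_Comp.IH(2) zs by blast
next
  case (eval_Prim0 f xs y g)
  from eval_Prim0.prems show ?case by cases (auto intro: eval_Prim0.IH)
next
  case (eval_PrimS f g n xs y y')
  from eval_PrimS.prems show ?case by cases (auto dest: eval_PrimS.IH)
next
  case (eval_Mn f n xs)
  from eval_Mn.prems have z: "eval f (z # xs) 0" "\<forall>m<z. \<exists>y. eval f (m # xs) y \<and> y > 0"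
    by (cases; auto)+
  have "\<not> z < n" using eval_Mn.IH(2) z(1) by (metis less_irrefl)
  moreover have "\<not> n < z" using eval_Mn.IH(1) z(2) by (metis less_irrefl)
  ultimately show ?case by simp
qed (auto elim: eval.cases)

section \<open>Programs for arithmetic and for inverting the pairing function\<close>

definition rec_add :: recf where "rec_add = Prim (Proj 0) (Comp Succ [Proj 0])"
definition rec_triangle :: recf where
  "rec_triangle = Prim Zero (Comp rec_add [Proj 0, Comp Succ [Proj 1]])"
definition rec_pred :: recf where "rec_pred = Prim Zero (Proj 1)"
text \<open>Primitive recursion runs on the first argument, so the subtrahend comes first:
  \<open>[n, m]\<close> is mapped to \<open>m - n\<close>.\<close>

definition rec_diff :: recf where "rec_diff = Prim (Proj 0) (Comp rec_pred [Proj 0])"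
definition rec_pair :: recf where
  "rec_pair = Comp rec_add [Comp rec_triangle [rec_add], Proj 0]"
text \<open>Since \<open>prod_encode (m, n)\<close> is \<open>triangle (m + n) + m\<close>, the
  diagonal \<open>m + n\<close> of \<open>z\<close> is the least \<open>s\<close> with
  \<open>z < triangle (Suc s)\<close>.\<close>

definition rec_diagonal :: recf where
  "rec_diagonal = Mn (Comp rec_diff [Comp rec_triangle [Comp Succ [Proj 0]], Comp Succ [Proj 1]])"
definition rec_fst :: recf where
  "rec_fst = Comp rec_diff [Comp rec_triangle [rec_diagonal], Proj 0]"
definition rec_snd :: recf where "rec_snd = Comp rec_diff [rec_fst, rec_diagonal]"

lemma eval_rec_add: "eval rec_add [m, n] (m + n)"
proof -
  have "eval rec_add [m, n] (rec_nat n (\<lambda>_. Suc) m)"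
    unfolding rec_add_def
    by (rule eval_Prim_rec_nat) (auto intro!: eval_Comp1 eval_Succ_1 eval_Proj_nth)
  moreover have "rec_nat n (\<lambda>_. Suc) m = m + n" by (induction m) auto
  ultimately show ?thesis by simp
qed

lemma eval_rec_triangle: "eval rec_triangle [n] (triangle n)"
proof -
  have "eval rec_triangle [n] (rec_nat 0 (\<lambda>n y. y + Suc n) n)"
    unfolding rec_triangle_def
    by (rule eval_Prim_rec_nat)
       (auto intro!: eval_Zero eval_Comp1 eval_Comp2 eval_Succ_1 eval_Proj_nth eval_rec_add
             simp flip: add_Suc_right)
  moreover have "rec_nat 0 (\<lambda>n y. y + Suc n) n = triangle n" by (induction n) auto
  ultimately show ?thesis by simp
qed

lemma eval_rec_pred: "eval rec_pred [n] (n - 1)"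
proof -
  have "eval rec_pred [n] (rec_nat 0 (\<lambda>n y. n) n)"
    unfolding rec_pred_def
    by (rule eval_Prim_rec_nat) (auto intro!: eval_Zero eval_Proj_nth)
  moreover have "rec_nat 0 (\<lambda>n y. n) n = n - 1" by (cases n) auto
  ultimately show ?thesis by simp
qed

lemma eval_rec_diff: "eval rec_diff [n, m] (m - n)"
proof -
  have "eval rec_diff [n, m] (rec_nat m (\<lambda>n y. y - 1) n)"
    unfolding rec_diff_def
    by (rule eval_Prim_rec_nat)
       (auto intro!: eval_Comp1 eval_Proj_nth eval_rec_pred[simplified])
  moreover have "rec_nat m (\<lambda>n y. y - 1) n = m - n" by (induction n) auto
  ultimately show ?thesis by simp
qed

lemma eval_rec_pair: "eval rec_pair [m, n] (prod_encode (m, n))"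
  unfolding rec_pair_def prod_encode_def prod.case
  by (auto intro!: eval_Comp1 eval_Comp2 eval_Proj_nth eval_rec_add eval_rec_triangle)

lemma triangle_mono: "m \<le> n \<Longrightarrow> triangle m \<le> triangle n"
  by (rule lift_Suc_mono_le[of triangle]) auto

lemma Least_triangle: "(LEAST s. Suc (prod_encode (m, n)) - triangle (Suc s) = 0) = m + n"
proof (rule Least_equality)
  show "Suc (prod_encode (m, n)) - triangle (Suc (m + n)) = 0"
    by (simp add: prod_encode_def)
  fix s assume *: "Suc (prod_encode (m, n)) - triangle (Suc s) = 0"
  show "m + n \<le> s"
  proof (rule ccontr)
    assume "\<not> m + n \<le> s"
    then have "triangle (Suc s) \<le> triangle (m + n)" by (intro triangle_mono) simp
    with * show False by (simp add: prod_encode_def)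
  qed
qed

lemma eval_rec_diagonal: "eval rec_diagonal [prod_encode (m, n)] (m + n)"
proof -
  let ?z = "prod_encode (m, n)"
  have "eval rec_diagonal [?z] (LEAST s. Suc ?z - triangle (Suc s) = 0)"
    unfolding rec_diagonal_def
  proof (rule eval_Mn_Least)
    have "Suc ?z - triangle (Suc (m + n)) = 0" by (simp add: prod_encode_def)
    then show "\<exists>s. Suc ?z - triangle (Suc s) = 0" ..
  qed (auto intro!: eval_Comp1 eval_Comp2 eval_Succ_1 eval_Proj_nth eval_rec_diff eval_rec_triangle
            simp del: triangle_Suc)
  then show ?thesis by (simp only: Least_triangle)
qed

lemma eval_rec_fst: "eval rec_fst [z] (fst (prod_decode z))"
proof (cases "prod_decode z")
  case (Pair m n)
  then have z: "z = prod_encode (m, n)" by (metis prod_decode_inverse)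
  have "eval rec_fst [z] (z - triangle (m + n))"
    unfolding rec_fst_def z
    by (rule eval_Comp2[OF eval_Comp1[OF eval_rec_diagonal eval_rec_triangle] _ eval_rec_diff])
       (auto intro!: eval_Proj_nth)
  then show ?thesis by (simp add: z) (simp add: prod_encode_def)
qed

lemma eval_rec_snd: "eval rec_snd [z] (snd (prod_decode z))"
proof (cases "prod_decode z")
  case (Pair m n)
  then have z: "z = prod_encode (m, n)" by (metis prod_decode_inverse)
  have "eval rec_snd [z] (m + n - m)"
    using eval_rec_fst[of z] unfolding rec_snd_def z
    by (intro eval_Comp2[OF _ eval_rec_diagonal eval_rec_diff]) simp
  then show ?thesis by (simp add: z)
qed

section \<open>Computable functions on encoded types\<close>

class enc =
  fixes enc :: "'a \<Rightarrow> nat"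
  assumes inj_enc: "inj enc"

lemma enc_eq_iff [simp]: "enc x = enc y \<longleftrightarrow> x = y"
  using inj_enc by (auto dest: injD)

instantiation nat :: enc
begin
definition enc_nat_def [simp]: "enc = (\<lambda>n::nat. n)"
instance by standard (auto intro: injI)
end

instantiation bool :: enc
begin
definition enc_bool :: "bool \<Rightarrow> nat" where [simp]: "enc_bool = of_bool"
instance by standard (auto intro!: injI simp: of_bool_def split: if_splits)
end

instantiation prod :: (enc, enc) enc
begin
definition enc_prod :: "'a \<times> 'b \<Rightarrow> nat" where
  [simp]: "enc_prod p = prod_encode (enc (fst p), enc (snd p))"
instance by standard (auto intro!: injI simp: prod_eq_iff)
end

instantiation list :: (enc) enc
begin
definition enc_list :: "'a list \<Rightarrow> nat" where "enc_list xs = list_encode (map enc xs)"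
instance
  by standard (auto intro!: injI simp: enc_list_def list_encode_eq inj_enc inj_map_eq_map)
end

lemma enc_Nil [simp]: "enc [] = 0"
  and enc_Cons [simp]: "enc (x # xs) = Suc (prod_encode (enc x, enc xs))"
  by (simp_all add: enc_list_def)

lemma surj_enc_nat: "surj (enc :: nat \<Rightarrow> nat)"
  by simp

lemma surj_enc_prod:
  assumes "surj (enc :: 'a::enc \<Rightarrow> nat)" "surj (enc :: 'b::enc \<Rightarrow> nat)"
  shows "surj (enc :: 'a \<times> 'b \<Rightarrow> nat)"
proof (rule surjI)
  fix n
  show "enc (inv (enc :: 'a \<Rightarrow> nat) (fst (prod_decode n)),
      inv (enc :: 'b \<Rightarrow> nat) (snd (prod_decode n))) = n"
    by (simp add: surj_f_inv_f[OF assms(1)] surj_f_inv_f[OF assms(2)])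
qed

lemma surj_enc_list:
  assumes "surj (enc :: 'a::enc \<Rightarrow> nat)"
  shows "surj (enc :: 'a list \<Rightarrow> nat)"
proof (rule surjI)
  fix n
  have "enc \<circ> inv (enc :: 'a \<Rightarrow> nat) = id" using assms by (simp add: surj_iff)
  then show "enc (map (inv (enc :: 'a \<Rightarrow> nat)) (list_decode n)) = n"
    by (simp add: enc_list_def)
qed

text \<open>Several inputs are passed as one encoded tuple. On numbers that are not codes the
  program is unconstrained.\<close>

definition computable :: "('a::enc \<Rightarrow> 'b::enc) \<Rightarrow> bool" where
  "computable f \<longleftrightarrow> (\<exists>t. \<forall>x. eval t [enc x] (enc (f x)))"

lemma computableI: "(\<And>x. eval t [enc x] (enc (f x))) \<Longrightarrow> computable f"
  unfolding computable_def by blast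

lemma computableE:
  assumes "computable f"
  obtains t where "\<And>x. eval t [enc x] (enc (f x))"
  using assms unfolding computable_def by blast

named_theorems comp_intro

lemma computable_compose:
  assumes "computable f" "computable g"
  shows "computable (\<lambda>x. f (g x))"
proof -
  obtain s t where "\<And>x. eval s [enc x] (enc (f x))" "\<And>x. eval t [enc x] (enc (g x))"
    using assms by (meson computableE)
  then have "eval (Comp s [t]) [enc x] (enc (f (g x)))" for x by (intro eval_Comp1)
  then show ?thesis by (rule computableI)
qed

lemma computable_id [comp_intro]: "computable (\<lambda>x. x)"
  by (rule computableI[of "Proj 0"]) (auto intro: eval_Proj_nth)

lemma computable_Suc [comp_intro]:
  assumes "computable f"
  shows "computable (\<lambda>x. Suc (f x))"
  by (rule computable_compose[OF computableI[of Succ] assms]) (auto intro: eval_Succ_1)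

lemma computable_const [comp_intro]: "computable (\<lambda>x. c)"
proof -
  have "\<exists>t. \<forall>x. eval t [x] k" for k
  proof (induction k)
    case 0
    then show ?case using eval_Zero by blast
  next
    case (Suc k)
    then obtain t where "eval t [x] k" for x by blast
    then have "eval (Comp Succ [t]) [x] (Suc k)" for x
      by (intro eval_Comp1[OF _ eval_Succ_1])
    then show ?case by blast
  qed
  then show ?thesis unfolding computable_def by blast
qed

lemma computable_Pair [comp_intro]:
  assumes "computable f" "computable g"
  shows "computable (\<lambda>x. (f x, g x))"
proof -
  obtain s t where "\<And>x. eval s [enc x] (enc (f x))" "\<And>x. eval t [enc x] (enc (g x))"
    using assms by (meson computableE)
  then have "eval (Comp rec_pair [s, t]) [enc x] (enc (f x, g x))" for x
    by (auto intro: eval_Comp2 eval_rec_pair)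
  then show ?thesis by (rule computableI)
qed

lemma computable_fst [comp_intro]:
  fixes f :: "'a::enc \<Rightarrow> 'b::enc \<times> 'c::enc"
  assumes "computable f"
  shows "computable (\<lambda>x. fst (f x))"
proof (rule computable_compose[OF computableI assms])
  fix p :: "'b \<times> 'c"
  show "eval rec_fst [enc p] (enc (fst p))" using eval_rec_fst[of "enc p"] by simp
qed

lemma computable_snd [comp_intro]:
  fixes f :: "'a::enc \<Rightarrow> 'b::enc \<times> 'c::enc"
  assumes "computable f"
  shows "computable (\<lambda>x. snd (f x))"
proof (rule computable_compose[OF computableI assms])
  fix p :: "'b \<times> 'c"
  show "eval rec_snd [enc p] (enc (snd p))" using eval_rec_snd[of "enc p"] by simp
qed

lemma computable_recode:
  assumes "\<And>x. enc (h x) = enc x" "computable f"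
  shows "computable (\<lambda>x. h (f x))"
  by (rule computable_compose[OF _ assms(2)], rule computableI[of "Proj 0"])
     (auto intro: eval_Proj_nth simp: assms)

lemma computable_of_bool [comp_intro]:
  "computable f \<Longrightarrow> computable (\<lambda>x. of_bool (f x) :: nat)"
  by (rule computable_recode[of of_bool]) auto

lemma computable_prod_decode [comp_intro]:
  "computable f \<Longrightarrow> computable (\<lambda>x. prod_decode (f x))"
  by (rule computable_recode[of prod_decode]) auto

lemma computable_list_decode [comp_intro]:
  "computable f \<Longrightarrow> computable (\<lambda>x. list_decode (f x))"
  by (rule computable_recode[of list_decode]) (auto simp: enc_list_def)

lemma computable_inv_enc:
  assumes "surj (enc :: 'a::enc \<Rightarrow> nat)" "computable f"
  shows "computable (\<lambda>x. inv (enc :: 'a \<Rightarrow> nat) (f x))"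
  by (rule computable_recode[OF _ assms(2)]) (simp add: surj_f_inv_f[OF assms(1)])

lemma computable_rec_nat [comp_intro]:
  fixes f :: "'a::enc \<Rightarrow> 'b::enc"
  assumes "computable f" "computable (\<lambda>p. g (fst (fst p)) (snd (fst p)) (snd p))" "computable h"
  shows "computable (\<lambda>x. rec_nat (f x) (g x) (h x))"
proof -
  obtain r s t where r: "\<And>x. eval r [enc x] (enc (f x))"
    and s: "\<And>p. eval s [enc p] (enc (g (fst (fst p)) (snd (fst p)) (snd p)))"
    and t: "\<And>x. eval t [enc x] (enc (h x))"
    using assms by (meson computableE)
  \<comment> \<open>\<open>Prim\<close> supplies value, counter and parameter in this order; they
    are repacked as \<open>((x, n), y)\<close>.\<close>
  let ?s = "Comp s [Comp rec_pair [Comp rec_pair [Proj 2, Proj 1], Proj 0]]"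
  have s': "eval ?s [enc y, n, enc x] (enc (g x n y))" for x n y
    using s[of "((x, n), y)"]
    by (auto intro!: eval_Comp1[of _ _ "enc ((x, n), y)"] eval_Comp2 eval_rec_pair eval_Proj_nth)
  have "eval (Prim r ?s) [n, enc x] (enc (rec_nat (f x) (g x) n))" for x n
  proof (induction n)
    case (Suc n)
    show ?case using eval_PrimS[OF Suc.IH s'] by simp
  qed (simp add: eval_Prim0 r)
  then have "eval (Comp (Prim r ?s) [t, Proj 0]) [enc x] (enc (rec_nat (f x) (g x) (h x)))" for x
    using t[of x] by (intro eval_Comp2[of t _ "h x" _ "enc x"]) (auto intro: eval_Proj_nth)
  then show ?thesis by (rule computableI)
qed

lemma computable_If [comp_intro]:
  fixes f :: "'a::enc \<Rightarrow> 'b::enc"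
  assumes "computable P" "computable f" "computable g"
  shows "computable (\<lambda>x. if P x then f x else g x)"
proof -
  have "(if P x then f x else g x) = rec_nat (g x) (\<lambda>_ _. f x) (of_bool (P x))" for x
    by auto
  then show ?thesis
    by (simp only:) (intro comp_intro assms computable_compose[OF assms(2)])
qed

lemma computable_Let [comp_intro]:
  assumes "computable f" "computable (\<lambda>p. g (fst p) (snd p))"
  shows "computable (\<lambda>x. let y = f x in g x y)"
proof -
  have "computable (\<lambda>x. (x, f x))" by (intro comp_intro assms)
  from computable_compose[OF assms(2) this] show ?thesis by (simp add: Let_def)
qed

lemma computable_not [comp_intro]:
  assumes "computable P"
  shows "computable (\<lambda>x. \<not> P x)"
proof -
  have "(\<not> P x) = (if P x then False else True)" for x by simp
  then show ?thesis by (simp only:) (intro comp_intro assms)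
qed

lemma computable_conj [comp_intro]:
  assumes "computable P" "computable Q"
  shows "computable (\<lambda>x. P x \<and> Q x)"
proof -
  have "(P x \<and> Q x) = (if P x then Q x else False)" for x by simp
  then show ?thesis by (simp only:) (intro comp_intro assms)
qed

lemma computable_disj [comp_intro]:
  assumes "computable P" "computable Q"
  shows "computable (\<lambda>x. P x \<or> Q x)"
proof -
  have "(P x \<or> Q x) = (if P x then True else Q x)" for x by simp
  then show ?thesis by (simp only:) (intro comp_intro assms)
qed

lemma computable_Least [comp_intro]:
  assumes "computable (\<lambda>p. P (fst p) (snd p))" "\<And>x. \<exists>n. P x n"
  shows "computable (\<lambda>x. LEAST n::nat. P x n)"
proof -
  have "computable (\<lambda>p. of_bool (\<not> P (fst p) (snd p)) :: nat)"
    by (intro comp_intro assms)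
  then obtain t where t: "\<And>p. eval t [enc p] (enc (of_bool (\<not> P (fst p) (snd p)) :: nat))"
    by (rule computableE) blast
  have "eval (Mn (Comp t [Comp rec_pair [Proj 1, Proj 0]])) [enc x]
      (LEAST n. of_bool (\<not> P x n) = (0::nat))" for x
  proof (rule eval_Mn_Least)
    fix n
    show "eval (Comp t [Comp rec_pair [Proj 1, Proj 0]]) [n, enc x] (of_bool (\<not> P x n))"
      using t[of "(x, n)"]
      by (auto intro!: eval_Comp1[of _ _ "enc (x, n)"] eval_Comp2 eval_rec_pair eval_Proj_nth)
  qed (use assms in auto)
  then show ?thesis by (intro computableI) auto
qed

section \<open>Arithmetic, comparisons and bounded quantifiers\<close>

lemma computable_diff [comp_intro]:
  fixes f g :: "'a::enc \<Rightarrow> nat"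
  assumes "computable f" "computable g"
  shows "computable (\<lambda>x. f x - g x)"
proof -
  have "eval (Comp rec_diff [rec_fst, rec_snd]) [enc p] (enc (snd p - fst p))" for p :: "nat \<times> nat"
    using eval_Comp2[OF eval_rec_fst[of "enc p"] eval_rec_snd[of "enc p"] eval_rec_diff] by simp
  then have "computable (\<lambda>p. snd p - fst p :: nat)" by (rule computableI)
  from computable_compose[OF this, of "\<lambda>x. (g x, f x)"] assms show ?thesis
    by (auto intro: comp_intro)
qed

lemma computable_le [comp_intro]:
  fixes f g :: "'a::enc \<Rightarrow> nat"
  assumes "computable f" "computable g"
  shows "computable (\<lambda>x. f x \<le> g x)"
proof -
  have "(m \<le> n) = rec_nat True (\<lambda>_ _. False) (m - n)" for m n :: nat
    by (cases "m - n") auto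
  then show ?thesis by (simp only:) (intro comp_intro assms)
qed

lemma computable_less [comp_intro]:
  fixes f g :: "'a::enc \<Rightarrow> nat"
  shows "computable f \<Longrightarrow> computable g \<Longrightarrow> computable (\<lambda>x. f x < g x)"
  unfolding less_eq_Suc_le by (intro comp_intro)

lemma computable_enc [comp_intro]: "computable f \<Longrightarrow> computable (\<lambda>x. enc (f x))"
  by (rule computable_recode[of enc]) auto

lemma computable_eq [comp_intro]:
  fixes f g :: "'a::enc \<Rightarrow> 'b::enc"
  assumes "computable f" "computable g"
  shows "computable (\<lambda>x. f x = g x)"
proof -
  have "(f x = g x) = (enc (f x) \<le> enc (g x) \<and> enc (g x) \<le> enc (f x))" for x
    by (metis antisym enc_eq_iff order_refl)
  then show ?thesis by (simp only:) (intro comp_intro assms)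
qed

lemma computable_bex_less [comp_intro]:
  assumes "computable (\<lambda>p. P (fst p) (snd p))" "computable b"
  shows "computable (\<lambda>x. \<exists>i<b x::nat. P x i)"
proof -
  have "(\<exists>i<b x. P x i) = ((LEAST i. b x \<le> i \<or> P x i) < b x)" for x
  proof
    assume "\<exists>i<b x. P x i"
    then obtain i where "i < b x" "P x i" by blast
    then have "(LEAST i. b x \<le> i \<or> P x i) \<le> i" by (intro Least_le) auto
    with \<open>i < b x\<close> show "(LEAST i. b x \<le> i \<or> P x i) < b x" by simp
  next
    have "b x \<le> (LEAST i. b x \<le> i \<or> P x i) \<or> P x (LEAST i. b x \<le> i \<or> P x i)"
      by (rule LeastI[of _ "b x"]) simp
    then show "(LEAST i. b x \<le> i \<or> P x i) < b x \<Longrightarrow> \<exists>i<b x. P x i" by auto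
  qed
  moreover have "\<exists>i. b x \<le> i \<or> P x i" for x by blast
  ultimately show ?thesis
    by (simp only:) (intro comp_intro assms computable_compose[OF assms(2)])
qed

lemma computable_ball_less [comp_intro]:
  assumes "computable (\<lambda>p. P (fst p) (snd p))" "computable b"
  shows "computable (\<lambda>x. \<forall>i<b x::nat. P x i)"
proof -
  have "computable (\<lambda>x. \<not> (\<exists>i<b x. \<not> P x i))" by (intro comp_intro assms)
  then show ?thesis by simp
qed

lemma computable_add [comp_intro]:
  fixes f g :: "'a::enc \<Rightarrow> nat"
  assumes "computable f" "computable g"
  shows "computable (\<lambda>x. f x + g x)"
proof -
  have "m + n = rec_nat n (\<lambda>_ y. Suc y) m" for m n :: nat by (induction m) auto
  then show ?thesis by (simp only:) (intro comp_intro assms)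
qed

lemma computable_mult [comp_intro]:
  fixes f g :: "'a::enc \<Rightarrow> nat"
  assumes "computable f" "computable g"
  shows "computable (\<lambda>x. f x * g x)"
proof -
  have "m * n = rec_nat 0 (\<lambda>_ y. n + y) m" for m n :: nat by (induction m) auto
  then show ?thesis
    by (simp only:) (intro comp_intro assms computable_compose[OF assms(2), of "\<lambda>x. fst (fst x)"])
qed

lemma computable_power [comp_intro]:
  fixes f g :: "'a::enc \<Rightarrow> nat"
  assumes "computable f" "computable g"
  shows "computable (\<lambda>x. f x ^ g x)"
proof -
  have "m ^ n = rec_nat 1 (\<lambda>_ y. m * y) n" for m n :: nat by (induction n) auto
  then show ?thesis
    by (simp only:) (intro comp_intro assms computable_compose[OF assms(1), of "\<lambda>x. fst (fst x)"])
qed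

lemma computable_div [comp_intro]:
  fixes f g :: "'a::enc \<Rightarrow> nat"
  assumes "computable f" "computable g"
  shows "computable (\<lambda>x. f x div g x)"
proof -
  have ex: "\<exists>q. n = 0 \<or> m < n * Suc q" for m n :: nat
    using dividend_less_times_div[of n m] by (auto intro!: exI[of _ "m div n"])
  \<comment> \<open>The disjunct \<open>n = 0\<close> ends the search at once and yields the
    convention \<open>m div 0 = 0\<close>.\<close>
  have "m div n = (LEAST q. n = 0 \<or> m < n * Suc q)" for m n :: nat
  proof (cases "n = 0")
    case False
    then show ?thesis
      using dividend_less_times_div[of n m]
      by (intro Least_equality[symmetric])
         (auto simp: less_Suc_eq_le[symmetric] mult.commute[of n] less_mult_imp_div_less
            simp del: mult_Suc mult_Suc_right, simp)
  qed simp
  then show ?thesis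
    by (simp only:)
       (intro comp_intro assms ex computable_compose[OF assms(1), of fst]
          computable_compose[OF assms(2), of fst])
qed

lemma computable_mod [comp_intro]:
  fixes f g :: "'a::enc \<Rightarrow> nat"
  assumes "computable f" "computable g"
  shows "computable (\<lambda>x. f x mod g x)"
  unfolding modulo_nat_def by (intro comp_intro assms)

section \<open>List operations\<close>

lemma computable_Cons [comp_intro]:
  assumes "computable f" "computable g"
  shows "computable (\<lambda>x. f x # g x)"
proof -
  obtain t where "\<And>x. eval t [enc x] (enc (f x, g x))"
    using computable_Pair[OF assms] by (meson computableE)
  then have "eval (Comp Succ [t]) [enc x] (enc (f x # g x))" for x
    by (auto intro!: eval_Comp1[OF _ eval_Succ_1])
  then show ?thesis by (rule computableI)
qed

lemma computable_of_code:
  assumes "computable g" "\<And>x. g (enc x) = enc (f x)"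
  shows "computable f"
proof -
  obtain t where t: "\<And>n. eval t [enc n] (enc (g n))" using assms(1) by (rule computableE) blast
  have "eval t [enc x] (enc (f x))" for x using t[of "enc x"] assms(2)[of x] by simp
  then show ?thesis by (rule computableI)
qed

lemma computable_tl [comp_intro]:
  assumes "computable f"
  shows "computable (\<lambda>x. tl (f x))"
proof (rule computable_compose[OF _ assms])
  have "computable (\<lambda>n. if n = 0 then 0 else snd (prod_decode (n - 1)))"
    by (intro comp_intro)
  moreover have "(if enc xs = 0 then 0 else snd (prod_decode (enc xs - 1))) = enc (tl xs)"
    for xs :: "'b list"
    by (cases xs) auto
  ultimately show "computable (tl :: 'b list \<Rightarrow> _)" by (rule computable_of_code)
qed

lemma computable_hd [comp_intro]:
  fixes f :: "'a::enc \<Rightarrow> 'b::enc list"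
  assumes "computable f"
  shows "computable (\<lambda>x. hd (f x))"
proof (rule computable_compose[OF _ assms])
  \<comment> \<open>\<open>hd []\<close> is unspecified but fixed, so its code is a
    constant.\<close>
  have "computable (\<lambda>n. if n = 0 then enc (hd [] :: 'b) else fst (prod_decode (n - 1)))"
    by (intro comp_intro)
  moreover have "(if enc xs = 0 then enc (hd [] :: 'b) else fst (prod_decode (enc xs - 1)))
      = enc (hd xs)" for xs :: "'b list"
    by (cases xs) auto
  ultimately show "computable (hd :: 'b list \<Rightarrow> _)" by (rule computable_of_code)
qed

lemma computable_drop [comp_intro]:
  assumes "computable f" "computable g"
  shows "computable (\<lambda>x. drop (f x) (g x))"
proof -
  have "drop n xs = rec_nat xs (\<lambda>_. tl) n" for n and xs :: "'b list"
    by (induction n) (auto simp: drop_Suc simp flip: tl_drop)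
  then show ?thesis by (simp only:) (intro comp_intro assms)
qed

lemma computable_length [comp_intro]:
  assumes "computable f"
  shows "computable (\<lambda>x. length (f x))"
proof -
  have "length xs = (LEAST n. drop n xs = [])" for xs :: "'b list"
    by (rule Least_equality[symmetric]) auto
  moreover have "\<exists>n. drop n xs = []" for xs :: "'b list" by auto
  ultimately show ?thesis
    by (simp only:) (intro comp_intro assms computable_compose[OF assms])
qed

lemma computable_bex_set [comp_intro]:
  assumes "computable (\<lambda>p. P (fst p) (snd p))" "computable f"
  shows "computable (\<lambda>x. \<exists>y\<in>set (f x). P x y)"
proof -
  have "(\<exists>y\<in>set (f x). P x y) = (\<exists>i<length (f x). P x (hd (drop i (f x))))" for x
    by (auto simp: Bex_def in_set_conv_nth hd_drop_conv_nth)
  moreover have "computable (\<lambda>p. (fst p, hd (drop (snd p) (f (fst p)))))"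
    by (intro comp_intro computable_compose[OF assms(2)])
  from computable_compose[OF assms(1) this]
  have "computable (\<lambda>p. P (fst p) (hd (drop (snd p) (f (fst p)))))" by simp
  ultimately show ?thesis by (simp only:) (intro comp_intro assms)
qed

lemma computable_in_set [comp_intro]:
  assumes "computable f" "computable g"
  shows "computable (\<lambda>x. f x \<in> set (g x))"
proof -
  have "computable (\<lambda>x. \<exists>y\<in>set (g x). y = f x)"
    by (intro comp_intro assms computable_compose[OF assms(1), of fst])
  then show ?thesis by simp
qed

section \<open>A universal enumeration of the semirecursive relations\<close>

primrec rcode :: "recf \<Rightarrow> nat" where
  "rcode Zero = prod_encode (0, 0)"
| "rcode Succ = prod_encode (1, 0)"
| "rcode (Proj i) = prod_encode (2, i)"
| "rcode (Comp f gs) = prod_encode (3, prod_encode (rcode f, list_encode (map rcode gs)))"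
| "rcode (Prim f g) = prod_encode (4, prod_encode (rcode f, rcode g))"
| "rcode (Mn f) = prod_encode (5, rcode f)"

declare rcode.simps [simp del]

type_synonym judgement = "nat \<times> nat list \<times> nat"

text \<open>A judgement \<open>(c, xs, y)\<close> asserts that the program with code \<open>c\<close> maps \<open>xs\<close> to \<open>y\<close>.\<close>

definition justified :: "judgement \<Rightarrow> judgement list \<Rightarrow> bool" where
  "justified J L \<longleftrightarrow>
    (let k = fst (prod_decode (fst J)); p = snd (prod_decode (fst J));
         xs = fst (snd J); y = snd (snd J); f = fst (prod_decode p); g = snd (prod_decode p)
     in if k = 0 then y = 0
        else if k = 1 then xs \<noteq> [] \<and> y = Suc (hd xs)
        else if k = 2 then p < length xs \<and> y = hd (drop p xs)
        else if k = 3 then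
          (\<exists>K\<in>set L. fst K = f \<and> snd (snd K) = y
            \<and> length (fst (snd K)) = length (list_decode g)
            \<and> (\<forall>i<length (list_decode g).
                 (hd (drop i (list_decode g)), xs, hd (drop i (fst (snd K)))) \<in> set L))
        else if k = 4 then
          xs \<noteq> [] \<and>
          (if hd xs = 0 then (f, tl xs, y) \<in> set L
           else \<exists>K\<in>set L. fst K = fst J \<and> fst (snd K) = (hd xs - 1) # tl xs
             \<and> (g, snd (snd K) # (hd xs - 1) # tl xs, y) \<in> set L)
        else (p, y # xs, 0) \<in> set L
          \<and> (\<forall>m<y. \<exists>K\<in>set L. fst K = p \<and> fst (snd K) = m # xs \<and> 0 < snd (snd K)))"

lemma computable_justified [comp_intro]:
  assumes "computable f" "computable g"
  shows "computable (\<lambda>x. justified (f x) (g x))"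
proof -
  have "computable (\<lambda>p. justified (fst p) (snd p))"
    unfolding justified_def by (intro comp_intro)
  from computable_compose[OF this computable_Pair[OF assms]] show ?thesis by simp
qed

fun derivation :: "judgement list \<Rightarrow> bool" where
  "derivation [] \<longleftrightarrow> True"
| "derivation (J # L) \<longleftrightarrow> justified J L \<and> derivation L"

text \<open>Quantifying over suffixes replaces the recursion over the list by a bounded quantifier,
  which the closure rules cover.\<close>

lemma derivation_iff:
  "derivation L \<longleftrightarrow> (\<forall>i<length L. justified (hd (drop i L)) (drop (Suc i) L))"
  by (induction L) (auto simp: All_less_Suc2)

lemma computable_derivation [comp_intro]:
  assumes "computable f"
  shows "computable (\<lambda>x. derivation (f x))"
  unfolding derivation_iff by (intro comp_intro assms computable_compose[OF assms])

text \<open>For numbers that code a program, this turns the arithmetic on codes back into the rules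
  of \<open>eval\<close>, read backwards.\<close>

lemma justified_simps [simp]:
  "justified (rcode Zero, xs, y) L \<longleftrightarrow> y = 0"
  "justified (rcode Succ, xs, y) L \<longleftrightarrow> xs \<noteq> [] \<and> y = Suc (hd xs)"
  "justified (rcode (Proj i), xs, y) L \<longleftrightarrow> i < length xs \<and> y = xs ! i"
  "justified (rcode (Comp f gs), xs, y) L \<longleftrightarrow>
     (\<exists>ys. (rcode f, ys, y) \<in> set L \<and> list_all2 (\<lambda>g z. (rcode g, xs, z) \<in> set L) gs ys)"
  "justified (rcode (Prim f g), xs, y) L \<longleftrightarrow> xs \<noteq> [] \<and>
     (case hd xs of 0 \<Rightarrow> (rcode f, tl xs, y) \<in> set L
      | Suc n \<Rightarrow> \<exists>z. (rcode (Prim f g), n # tl xs, z) \<in> set L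
          \<and> (rcode g, z # n # tl xs, y) \<in> set L)"
  "justified (rcode (Mn f), xs, y) L \<longleftrightarrow> (rcode f, y # xs, 0) \<in> set L
     \<and> (\<forall>m<y. \<exists>z>0. (rcode f, m # xs, z) \<in> set L)"
  by (force simp: rcode.simps justified_def hd_drop_conv_nth list_all2_conv_all_nth Let_def Bex_def
      split: nat.split)+

lemma derivation_sound:
  "derivation L \<Longrightarrow> (rcode f, xs, y) \<in> set L \<Longrightarrow> eval f xs y"
proof (induction L arbitrary: f xs y)
  case (Cons J L)
  have IH: "eval f xs y" if "(rcode f, xs, y) \<in> set L" for f xs y
    using Cons that by auto
  show ?case
  proof (cases "(rcode f, xs, y) \<in> set L")
    case False
    with Cons.prems have J: "justified (rcode f, xs, y) L" by auto
    show ?thesis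
    proof (cases f)
      case Zero
      then show ?thesis using J by (simp add: eval_Zero)
    next
      case Succ
      then show ?thesis using J by (cases xs) (auto simp: eval_Succ)
    next
      case (Proj i)
      then show ?thesis using J by (auto simp: eval_Proj)
    next
      case (Comp g gs)
      then obtain ys where "(rcode g, ys, y) \<in> set L"
        "list_all2 (\<lambda>g z. (rcode g, xs, z) \<in> set L) gs ys"
        using J by auto
      then show ?thesis unfolding Comp
        by (intro eval_Comp[where ys = ys]) (auto intro: IH elim: list_all2_mono)
    next
      case (Prim g h)
      show ?thesis
      proof (cases xs)
        case (Cons n ns)
        then show ?thesis using J Prim
          by (cases n) (auto intro: eval_Prim0 eval_PrimS IH)
      qed (use J Prim in \<open>auto\<close>)
    next
      case (Mn g)
      then have "(rcode g, y # xs, 0) \<in> set L" "\<forall>m<y. \<exists>z>0. (rcode g, m # xs, z) \<in> set L"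
        using J by auto
      then show ?thesis unfolding Mn by (meson IH eval_Mn)
    qed
  qed (rule IH)
qed simp

lemma justified_mono: "justified J L \<Longrightarrow> set L \<subseteq> set L' \<Longrightarrow> justified J L'"
  unfolding justified_def Let_def by (auto split: if_splits) (meson subsetD)+

lemma derivation_append: "derivation L \<Longrightarrow> derivation L' \<Longrightarrow> derivation (L @ L')"
  by (induction L) (auto elim: justified_mono)

lemma derivation_collect:
  assumes "finite S" "\<And>J. J \<in> S \<Longrightarrow> \<exists>L. derivation L \<and> J \<in> set L"
  shows "\<exists>L. derivation L \<and> S \<subseteq> set L"
  using assms
proof (induction S)
  case (insert J S)
  then obtain L L' where "derivation L" "J \<in> set L" "derivation L'" "S \<subseteq> set L'"
    by (metis insertCI)
  then show ?case using derivation_append[of L L'] by (intro exI[of _ "L @ L'"]) auto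
qed (auto intro: exI[of _ "[]"])

text \<open>Derivations can be concatenated, so finitely many premises fit into a single one, and
  the conclusion is put in front of it.\<close>

lemma derivation_step:
  assumes "finite S" "\<And>J. J \<in> S \<Longrightarrow> \<exists>L. derivation L \<and> J \<in> set L"
    and "\<And>L. S \<subseteq> set L \<Longrightarrow> justified J L"
  shows "\<exists>L. derivation L \<and> J \<in> set L"
proof -
  obtain L where "derivation L" "S \<subseteq> set L" using derivation_collect[OF assms(1,2)] by blast
  then have "derivation (J # L)" using assms(3) by simp
  then show ?thesis by (meson list.set_intros(1))
qed

lemma derivation_complete:
  "eval f xs y \<Longrightarrow> \<exists>L. derivation L \<and> (rcode f, xs, y) \<in> set L"
proof (induction rule: eval.induct)
  case (eval_Zero xs)
  show ?case by (rule derivation_step[of "{}"]) auto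
next
  case (eval_Succ x xs)
  show ?case by (rule derivation_step[of "{}"]) auto
next
  case (eval_Proj i xs)
  show ?case by (rule derivation_step[of "{}"]) (use eval_Proj in auto)
next
  case (eval_Comp xs gs ys f z)
  let ?S = "insert (rcode f, ys, z) ((\<lambda>i. (rcode (gs ! i), xs, ys ! i)) ` {..<length gs})"
  show ?case
  proof (rule derivation_step[of ?S])
    fix L assume "?S \<subseteq> set L"
    then show "justified (rcode (Comp f gs), xs, z) L"
      using eval_Comp.IH(1)
      by (auto simp: list_all2_conv_all_nth image_subset_iff
          intro!: exI[of _ ys])
  qed (use eval_Comp.IH in \<open>auto simp: list_all2_conv_all_nth\<close>)
next
  case (eval_Prim0 f xs z g)
  show ?case by (rule derivation_step[of "{(rcode f, xs, z)}"]) (use eval_Prim0 in auto)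
next
  case (eval_PrimS f g n xs y z)
  show ?case
    by (rule derivation_step[of "{(rcode (Prim f g), n # xs, y), (rcode g, y # n # xs, z)}"])
       (use eval_PrimS in auto)
next
  case (eval_Mn f n xs)
  \<comment> \<open>Fixing one positive value \<open>h m\<close> for each \<open>m < n\<close> turns
    the premises of minimization into a finite set of judgements.\<close>
  then obtain h where h: "\<And>m. m < n \<Longrightarrow>
      (\<exists>L. derivation L \<and> (rcode f, m # xs, h m) \<in> set L) \<and> h m > 0"
    by metis
  show ?case
  proof (rule derivation_step)
    let ?S = "insert (rcode f, n # xs, 0) ((\<lambda>m. (rcode f, m # xs, h m)) ` {..<n})"
    show "finite ?S" by simp
    show "\<exists>L. derivation L \<and> J \<in> set L" if "J \<in> ?S" for J
      using that h eval_Mn.IH(1) by auto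
    show "justified (rcode (Mn f), xs, n) L" if "?S \<subseteq> set L" for L
      using that h by auto
  qed
qed

text \<open>Every number codes a list of judgements, so \<open>inv enc\<close> leaves codes
  unchanged and is computable.\<close>

lemma surj_enc_judgements: "surj (enc :: judgement list \<Rightarrow> nat)"
  by (intro surj_enc_list surj_enc_prod surj_enc_nat)

text \<open>The pair \<open>j\<close> codes an element of the \<open>\<Sigma>\<^sub>3\<close> set together with the witness of its outermost
  existential quantifier; \<open>c\<close> codes the innermost witness together with a derivation.\<close>

definition kleene :: "nat \<Rightarrow> nat \<Rightarrow> nat \<Rightarrow> nat \<Rightarrow> bool" where
  "kleene e j b c \<longleftrightarrow>
    (let L = inv enc (snd (prod_decode c))
     in derivation L
       \<and> (e, [fst (prod_decode j), snd (prod_decode j), b, fst (prod_decode c)], 1) \<in> set L)"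

lemma computable_kleene [comp_intro]:
  assumes "computable e" "computable j" "computable b" "computable c"
  shows "computable (\<lambda>x. kleene (e x) (j x) (b x) (c x))"
proof -
  have "computable (\<lambda>x. kleene (fst x) (fst (snd x)) (fst (snd (snd x))) (snd (snd (snd x))))"
    unfolding kleene_def by (intro comp_intro computable_inv_enc surj_enc_judgements)
  moreover have "computable (\<lambda>x. (e x, j x, b x, c x))" by (intro comp_intro assms)
  ultimately show ?thesis using computable_compose by fastforce
qed

lemma ex_kleene_iff:
  "(\<exists>c. kleene (rcode f) (prod_encode (x, a)) b c) \<longleftrightarrow> (\<exists>c. eval f [x, a, b, c] 1)"
proof
  assume "\<exists>c. kleene (rcode f) (prod_encode (x, a)) b c"
  then show "\<exists>c. eval f [x, a, b, c] 1"
    unfolding kleene_def Let_def using derivation_sound by fastforce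
next
  assume "\<exists>c. eval f [x, a, b, c] 1"
  then obtain c L where L: "derivation L" "(rcode f, [x, a, b, c], 1) \<in> set L"
    using derivation_complete by blast
  have "inv enc (enc L) = L" by (simp add: inj_enc)
  with L have "kleene (rcode f) (prod_encode (x, a)) b (prod_encode (c, enc L))"
    unfolding kleene_def by simp
  then show "\<exists>c. kleene (rcode f) (prod_encode (x, a)) b c" ..
qed

text \<open>The index is \<open>rcode t\<close>, where \<open>t\<close> decides the matrix.
  Replacing "the matrix holds" by "some derivation yields output 1" gives one computable kernel that
  is uniform in \<open>e\<close>.\<close>

lemma Sigma03_kleene:
  assumes "Sigma03 A"
  obtains e where "\<And>x. x \<in> A \<longleftrightarrow> (\<exists>a. \<forall>b. \<exists>c. kleene e (prod_encode (x, a)) b c)"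
proof -
  obtain R t where A: "\<And>x. x \<in> A \<longleftrightarrow> (\<exists>a. \<forall>b. \<exists>c. R [x, a, b, c])"
    and t: "\<And>xs. length xs = 4 \<Longrightarrow> eval t xs (if R xs then 1 else 0)"
    using assms unfolding Sigma03_def recursive_rel_def by blast
  have "eval t xs 1 \<longleftrightarrow> R xs" if "length xs = 4" for xs
    using t[OF that] eval_deterministic by (fastforce split: if_splits)
  then show thesis by (intro that[of "rcode t"]) (simp add: A ex_kleene_iff)
qed

section \<open>Ternary digits\<close>

definition digit :: "nat \<Rightarrow> nat \<Rightarrow> nat" where
  "digit n p = n div 3 ^ p mod 3"

lemma digit_eq_0_of_dvd: "3 ^ s dvd n \<Longrightarrow> p < s \<Longrightarrow> digit n p = 0"
proof -
  assume "3 ^ s dvd n" "p < s"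
  then have "3 ^ p * 3 dvd n"
    by (metis Suc_leI dvd_trans le_imp_power_dvd power_Suc2)
  then show ?thesis unfolding digit_def by auto
qed

lemma digit_add_low:
  assumes "3 ^ s dvd y" "p < s"
  shows "digit (x + y) p = digit x p"
proof -
  obtain k where "y = 3 ^ p * (3 * k)"
    using assms by (metis Suc_leI dvdE dvd_trans le_imp_power_dvd mult.assoc power_Suc2)
  then show ?thesis by (simp add: digit_def)
qed

lemma digit_add_high:
  assumes "3 ^ s dvd y" "x < 3 ^ s" "s \<le> p"
  shows "digit (x + y) p = digit y p"
proof -
  obtain k where k: "y = 3 ^ s * k" using assms by blast
  have p: "(3::nat) ^ p = 3 ^ s * 3 ^ (p - s)" using assms by (simp flip: power_add)
  show ?thesis using assms(2) by (simp add: digit_def k p div_mult2_eq)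
qed

lemma digit_eq_0_of_less: "n < 3 ^ p \<Longrightarrow> digit n p = 0"
  by (simp add: digit_def)

lemma lowest_digit_ex:
  assumes "0 < n"
  obtains s where "3 ^ s dvd n" "digit n s \<noteq> 0"
proof -
  let ?P = "\<lambda>s. \<not> 3 ^ s dvd n"
  have "?P n" using assms power_gt_expt[of 3 n] by (auto dest!: dvd_imp_le)
  then have "?P (LEAST s. ?P s)" by (rule LeastI)
  moreover from this obtain s where s: "(LEAST s. ?P s) = Suc s"
    by (cases "LEAST s. ?P s") auto
  moreover have "3 ^ s dvd n" using s not_less_Least[of s ?P] by auto
  ultimately have "3 ^ s dvd n" "\<not> 3 ^ Suc s dvd n" by auto
  moreover from this have "digit n s \<noteq> 0"
    unfolding digit_def by (auto elim!: dvdE simp: mod_greater_zero_iff_not_dvd)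
  ultimately show thesis by (intro that)
qed

definition num_digits :: "nat \<Rightarrow> nat" where
  "num_digits n = (LEAST t. n < 3 ^ t)"

lemma less_power_num_digits: "n < 3 ^ num_digits n"
  unfolding num_digits_def by (rule LeastI[of _ n]) (simp add: power_gt_expt)

text \<open>If \<open>v < 3 ^ t\<close>, both are multiples of \<open>3 ^ s\<close>, so they differ
  by at least \<open>3 ^ s > x\<close>. This is what lets \<open>x + v\<close> and \<open>v\<close>
  be scanned against the same table.\<close>

lemma num_digits_add:
  assumes "3 ^ s dvd v" "0 < v" "x < 3 ^ s"
  shows "num_digits (x + v) = num_digits v"
proof -
  have "x + v < 3 ^ t \<longleftrightarrow> v < 3 ^ t" for t
  proof
    assume v: "v < 3 ^ t"
    with assms(1,2) have "s \<le> t"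
      by (meson dvd_imp_le le_less_trans less_imp_le_nat one_less_numeral_iff
          power_less_imp_less_exp semiring_norm(77))
    then obtain k where k: "(3::nat) ^ t = 3 ^ s * k" by (metis dvdE le_imp_power_dvd)
    obtain l where l: "v = 3 ^ s * l" using assms by blast
    have "Suc l \<le> k" using v by (simp add: k l)
    then have "3 ^ s * Suc l \<le> 3 ^ t" unfolding k by (rule mult_le_mono2)
    then show "x + v < 3 ^ t" using assms(3) by (simp add: l)
  qed simp
  then show ?thesis by (simp add: num_digits_def)
qed

section \<open>Scanning a number against a list of claims\<close>

text \<open>A number is scanned from its lowest digit upwards; the state consists of the current segment
  (a number whose ternary digits are a block of consecutive digits of \<open>n\<close>, in place) and a parity. A
  claim \<open>(p, w, r)\<close> says: if a nonzero digit at position \<open>p\<close> is reached with current segment \<open>w\<close>,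
  then start a new segment there and add \<open>r\<close> to the parity.\<close>

definition scan_step :: "(nat \<times> nat \<times> bool) list \<Rightarrow> nat \<Rightarrow> nat \<Rightarrow> nat \<times> bool \<Rightarrow> nat \<times> bool" where
  "scan_step T n p q = (let d = digit n p * 3 ^ p in
     if d = 0 then q
     else if (p, fst q, True) \<in> set T then (d, \<not> snd q)
     else if (p, fst q, False) \<in> set T then (d, snd q)
     else (fst q + d, snd q))"

definition scan :: "(nat \<times> nat \<times> bool) list \<Rightarrow> nat \<Rightarrow> nat \<Rightarrow> nat \<times> bool" where
  "scan T n = rec_nat (0, False) (scan_step T n)"

lemma scan_0 [simp]: "scan T n 0 = (0, False)"
  and scan_Suc: "scan T n (Suc p) = scan_step T n p (scan T n p)"
  by (simp_all add: scan_def)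

lemma scan_cong:
  assumes "\<And>p. p < s \<Longrightarrow> digit n p = digit n' p"
    and "\<And>p w r. p < s \<Longrightarrow> (p, w, r) \<in> set T \<longleftrightarrow> (p, w, r) \<in> set T'"
  shows "scan T n s = scan T' n' s"
  using assms by (induction s) (simp_all add: scan_Suc scan_step_def Let_def)

lemma scan_digits_0:
  assumes "\<And>p. p < s \<Longrightarrow> digit n p = 0"
  shows "scan T n s = (0, False)"
  using assms by (induction s) (simp_all add: scan_Suc scan_step_def)

lemma scan_beyond:
  assumes "n < 3 ^ s" "s \<le> s'"
  shows "scan T n s' = scan T n s"
  using assms(2)
proof (induction s' rule: dec_induct)
  case (step p)
  then have "n < 3 ^ p" using assms(1) by (meson less_le_trans power_increasing one_le_numeral)
  then show ?case using step by (simp add: scan_Suc scan_step_def digit_eq_0_of_less)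
qed simp

text \<open>The last segment contains the leading nonzero digit, which bounds the number up to a
  factor of 3.\<close>

lemma le_fst_scan: "n mod 3 ^ s \<le> 3 * fst (scan T n s)"
proof (induction s)
  case (Suc s)
  have n: "n mod 3 ^ Suc s = 3 ^ s * digit n s + n mod 3 ^ s"
    by (simp add: digit_def mod_mult2_eq mult.commute[of 3])
  show ?case
  proof (cases "digit n s = 0")
    case True
    then show ?thesis using Suc n by (simp add: scan_Suc scan_step_def)
  next
    case False
    have "3 ^ s \<le> digit n s * 3 ^ s" using False by simp
    moreover have "n mod 3 ^ Suc s < 3 * 3 ^ s" by simp
    moreover have "digit n s * 3 ^ s \<le> fst (scan T n (Suc s))"
      using False by (simp add: scan_Suc scan_step_def Let_def)
    ultimately show ?thesis by linarith
  qed
qed simp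

text \<open>The scan of \<open>x + v\<close> restarts at the first digit of \<open>v\<close>, and the label of the claim is chosen
  such that the parity accumulated up to there is odd.\<close>

lemma scan_add_flip:
  assumes v: "3 ^ s dvd v" "digit v s \<noteq> 0" and x: "x < 3 ^ s"
    and T: "\<And>p. (p, 0, True) \<notin> set T" "(s, fst q, \<not> snd q) \<in> set T" "(s, fst q, snd q) \<notin> set T"
    and q: "scan T x s = q"
    and "s < t"
  shows "snd (scan T (x + v) t) = (\<not> snd (scan T v t))"
proof -
  have xs: "scan T (x + v) s = q"
    using scan_cong[of s "x + v" x T T] digit_add_low[OF v(1)] q by auto
  have vs: "scan T v s = (0, False)"
    using digit_eq_0_of_dvd[OF v(1)] by (rule scan_digits_0)
  \<comment> \<open>After position \<open>s\<close> both scans hold just the digit of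
    \<open>v\<close> at \<open>s\<close> as segment, with odd parity for \<open>x + v\<close> and
    even parity for \<open>v\<close>. From there they read the same digits and meet the same
    claims.\<close>
  have "fst (scan T (x + v) t) = fst (scan T v t) \<and> snd (scan T (x + v) t) = (\<not> snd (scan T v t))"
    using Suc_leI[OF \<open>s < t\<close>]
  proof (induction t rule: dec_induct)
    case base
    have "digit (x + v) s = digit v s" using digit_add_high[OF v(1) x] by simp
    then show ?case using xs vs v T by (cases "snd q") (auto simp: scan_Suc scan_step_def Let_def)
  next
    case (step p)
    have "digit (x + v) p = digit v p" using digit_add_high[OF v(1) x] step by simp
    then show ?case using step by (auto simp: scan_Suc scan_step_def Let_def)
  qed
  then show ?thesis ..
qed

section \<open>The claims\<close>

text \<open>Here \<open>act e j s\<close> means that the pair \<open>j\<close>, coding an element and a witness for the \<open>e\<close>-th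
  \<open>\<Sigma>\<^sub>3\<close> set, is not yet refuted at stage \<open>s\<close>.\<close>

definition eligible ::
  "(nat \<Rightarrow> nat \<Rightarrow> nat \<Rightarrow> bool) \<Rightarrow> nat \<Rightarrow> nat \<Rightarrow> (nat \<times> nat \<times> bool) list \<Rightarrow> nat \<Rightarrow> bool" where
  "eligible act s e L j \<longleftrightarrow> act e j s \<and>
     (let w = fst (scan L (fst (prod_decode j)) s)
      in (s, w, True) \<notin> set L \<and> (s, w, False) \<notin> set L)"

text \<open>The search is total because it stops at \<open>s\<close>, which then means that no pair
  was found. The label \<open>\<not> snd q\<close> makes the parity right after the cut odd.\<close>

definition add_claim ::
  "(nat \<Rightarrow> nat \<Rightarrow> nat \<Rightarrow> bool) \<Rightarrow> nat \<Rightarrow> nat \<Rightarrow> (nat \<times> nat \<times> bool) list \<Rightarrow> (nat \<times> nat \<times> bool) list" where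
  "add_claim act s e L = (let j = LEAST j. s \<le> j \<or> eligible act s e L j in
     if j < s
     then let q = scan L (fst (prod_decode j)) s in (s, fst q, \<not> snd q) # L
     else L)"

text \<open>The dummy claim of the empty segment \<open>0\<close> does not influence any scan; it merely prevents
  \<open>0\<close> from being claimed with the other label.\<close>

definition claims ::
  "(nat \<Rightarrow> nat \<Rightarrow> nat \<Rightarrow> bool) \<Rightarrow> nat \<Rightarrow> (nat \<times> nat \<times> bool) list \<Rightarrow> nat \<Rightarrow> (nat \<times> nat \<times> bool) list" where
  "claims act s T = rec_nat ((s, 0, False) # T) (add_claim act s)"

definition table :: "(nat \<Rightarrow> nat \<Rightarrow> nat \<Rightarrow> bool) \<Rightarrow> nat \<Rightarrow> (nat \<times> nat \<times> bool) list" where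
  "table act = rec_nat [] (\<lambda>s T. claims act s T s)"

section \<open>Locality, consistency and number of the claims\<close>

lemma claims_0 [simp]: "claims act s T 0 = (s, 0, False) # T"
  and claims_Suc: "claims act s T (Suc e) = add_claim act s e (claims act s T e)"
  by (simp_all add: claims_def)

lemma table_0 [simp]: "table act 0 = []"
  and table_Suc: "table act (Suc s) = claims act s (table act s) s"
  by (simp_all add: table_def)

lemma add_claim_cases:
  obtains "add_claim act s e L = L"
  | j where "j < s" "eligible act s e L j"
      "add_claim act s e L =
        (s, fst (scan L (fst (prod_decode j)) s), \<not> snd (scan L (fst (prod_decode j)) s)) # L"
proof (cases "(LEAST j. s \<le> j \<or> eligible act s e L j) < s")
  case True
  moreover have "s \<le> (LEAST j. s \<le> j \<or> eligible act s e L j)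
      \<or> eligible act s e L (LEAST j. s \<le> j \<or> eligible act s e L j)"
    by (rule LeastI[of _ s]) simp
  ultimately show thesis by (intro that(2)) (auto simp: add_claim_def Let_def)
qed (auto intro!: that(1) simp: add_claim_def Let_def)

lemma add_claim_eligible:
  assumes "eligible act s e L j" "j < s"
  obtains i where "i \<le> j" "eligible act s e L i"
      "add_claim act s e L =
        (s, fst (scan L (fst (prod_decode i)) s), \<not> snd (scan L (fst (prod_decode i)) s)) # L"
proof -
  let ?i = "LEAST j. s \<le> j \<or> eligible act s e L j"
  have le: "?i \<le> j" using assms by (intro Least_le) simp
  have "s \<le> ?i \<or> eligible act s e L ?i" by (rule LeastI[of _ s]) simp
  with le assms show thesis by (intro that[of ?i]) (auto simp: add_claim_def Let_def)
qed

lemma set_claims_mono: "e \<le> e' \<Longrightarrow> set (claims act s T e) \<subseteq> set (claims act s T e')"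
proof (induction e' rule: dec_induct)
  case (step e')
  have "set (claims act s T e') \<subseteq> set (claims act s T (Suc e'))"
    by (cases rule: add_claim_cases[of act s e' "claims act s T e'"]) (auto simp: claims_Suc)
  with step show ?case by blast
qed simp

lemma claims_subset: "set (claims act s T e) \<subseteq> set T \<union> {s} \<times> UNIV"
proof (induction e)
  case (Suc e)
  then show ?case
    by (cases rule: add_claim_cases[of act s e "claims act s T e"]) (auto simp: claims_Suc)
qed simp

lemma in_claims_iff: "p \<noteq> s \<Longrightarrow> (p, q) \<in> set (claims act s T e) \<longleftrightarrow> (p, q) \<in> set T"
  using claims_subset[of act s T e] set_claims_mono[of 0 e act s T] by auto

lemma in_table_less: "(p, q) \<in> set (table act s) \<Longrightarrow> p < s"
proof (induction s)
  case (Suc s)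
  then show ?case using claims_subset[of act s "table act s" s] by (auto simp: table_Suc less_Suc_eq)
qed simp

text \<open>Stage \<open>s\<close> adds claims at position \<open>s\<close> only, so the claims at a
  position are final after its own stage.\<close>

lemma in_table_iff: "p < s \<Longrightarrow> s \<le> s' \<Longrightarrow> (p, q) \<in> set (table act s') \<longleftrightarrow> (p, q) \<in> set (table act s)"
  by (rotate_tac, induction s' rule: dec_induct) (auto simp: table_Suc in_claims_iff)

text \<open>A scan up to \<open>s\<close> consults only claims at positions below \<open>s\<close>;
  hence all indices see the same segments during stage \<open>s\<close>.\<close>

lemma scan_claims: "scan (claims act s T e) n s = scan T n s"
  by (rule scan_cong) (auto simp: in_claims_iff)

text \<open>Supplies the hypotheses of \<open>scan_add_flip\<close> that forbid a second label and a
  parity change at the empty segment.\<close>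

definition consistent :: "(nat \<times> nat \<times> bool) list \<Rightarrow> bool" where
  "consistent L \<longleftrightarrow> (\<forall>p w r. (p, w, r) \<in> set L \<longrightarrow> (p, w, \<not> r) \<notin> set L \<and> (w = 0 \<longrightarrow> \<not> r))"

lemma consistent_claims:
  assumes "consistent T" "\<And>q. (s, q) \<notin> set T"
  shows "consistent (claims act s T e)"
proof (induction e)
  case 0
  show ?case using assms by (auto simp: consistent_def)
next
  case (Suc e)
  let ?L = "claims act s T e"
  have 0: "(s, 0, False) \<in> set ?L" using set_claims_mono[of 0 e act s T] by auto
  show ?case
  proof (cases rule: add_claim_cases[of act s e ?L])
    case 1
    then show ?thesis using Suc by (simp add: claims_Suc)
  next
    case (2 j)
    obtain w r where q: "scan ?L (fst (prod_decode j)) s = (w, r)" by fastforce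
    have "(s, w, b) \<notin> set ?L" for b
      using 2(2) q by (cases b) (auto simp: eligible_def Let_def)
    then show ?thesis using Suc 0 2(3)
      unfolding claims_Suc consistent_def q by auto
  qed
qed

lemma consistent_table: "consistent (table act s)"
proof (induction s)
  case (Suc s)
  then show ?case using in_table_less[of s _ act s]
    by (auto simp: table_Suc intro!: consistent_claims)
qed (simp add: consistent_def)

text \<open>The dummy claim accounts for one segment, and each turn adds at most one more.\<close>

lemma card_claimed: "card (fst ` {q. (s, q) \<in> set (claims act s (table act s) e)}) \<le> Suc e"
proof (induction e)
  case 0
  have "{q. (s, q) \<in> set (claims act s (table act s) 0)} = {(0, False)}"
    using in_table_less[of s _ act s] by auto
  then show ?case by simp
next
  case (Suc e)
  let ?L = "claims act s (table act s) e"
  show ?case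
  proof (cases rule: add_claim_cases[of act s e ?L])
    case 1
    then show ?thesis using Suc by (simp add: claims_Suc)
  next
    case (2 j)
    let ?q = "scan ?L (fst (prod_decode j)) s"
    have "{q. (s, q) \<in> set (claims act s (table act s) (Suc e))}
        = insert (fst ?q, \<not> snd ?q) {q. (s, q) \<in> set ?L}"
      using 2(3) by (auto simp: claims_Suc)
    then show ?thesis using Suc card_insert_le_m1[of "Suc (Suc e)"]
      by (simp add: card_insert_le_m1)
  qed
qed

text \<open>Stage \<open>s'\<close> gives a turn only to indices below \<open>s'\<close> and
  searches only pairs below \<open>s'\<close>, so a table depends on a finite part of
  \<open>act\<close>.\<close>

lemma table_cong:
  assumes "\<And>s' e j. s' < s \<Longrightarrow> e < s' \<Longrightarrow> j < s' \<Longrightarrow> act e j s' = act' e j s'"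
  shows "table act s = table act' s"
  using assms
proof (induction s)
  case (Suc s)
  have add: "add_claim act s e L = add_claim act' s e L" if "e < s" for e L
  proof -
    have "(s \<le> j \<or> eligible act s e L j) = (s \<le> j \<or> eligible act' s e L j)" for j
      using Suc.prems[of s e j] that by (cases "s \<le> j") (auto simp: eligible_def)
    then show ?thesis by (simp only: add_claim_def)
  qed
  have "claims act s T e = claims act' s T e" if "e \<le> s" for T e
    using that by (induction e) (simp_all add: claims_Suc add)
  then show ?case using Suc by (simp add: table_Suc)
qed simp

text \<open>A pair is refuted by a \<open>b\<close> for which no \<open>c\<close> exists, and stage
  \<open>s\<close> tests \<open>b < s\<close>. Bounding \<open>c\<close> by \<open>t\<close> makes
  the test decidable, at the price of spurious refutations for small \<open>t\<close>.\<close>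

definition active :: "nat \<Rightarrow> nat \<Rightarrow> nat \<Rightarrow> nat \<Rightarrow> bool" where
  "active t e j s \<longleftrightarrow> (\<forall>b<s. \<exists>c<t. kleene e j b c)"

definition active_lim :: "nat \<Rightarrow> nat \<Rightarrow> nat \<Rightarrow> bool" where
  "active_lim e j s \<longleftrightarrow> (\<forall>b<s. \<exists>c. kleene e j b c)"

lemma table_active_eventually:
  obtains t0 where "\<And>t. t0 \<le> t \<Longrightarrow> table (active t) s = table active_lim s"
proof -
  \<comment> \<open>\<open>C\<close> picks a witness where one exists; \<open>t0\<close> will exceed
    its values on the finitely many triples below \<open>s\<close>.\<close>
  define C where "C = (\<lambda>(e, j, b). SOME c. kleene e j b c)"
  have "finite (C ` ({..<s} \<times> {..<s} \<times> {..<s}))" by blast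
  then obtain t0 where t0: "\<And>c. c \<in> C ` ({..<s} \<times> {..<s} \<times> {..<s}) \<Longrightarrow> c < t0"
    unfolding finite_nat_set_iff_bounded by blast
  have "active t e j s' = active_lim e j s'" if "t0 \<le> t" "s' < s" "e < s'" "j < s'" for t e j s'
  proof -
    have "\<exists>c<t. kleene e j b c" if "b < s'" "kleene e j b c" for b c
    proof -
      have "C (e, j, b) < t0"
        using \<open>s' < s\<close> \<open>e < s'\<close> \<open>j < s'\<close> that by (intro t0 imageI) auto
      moreover have "kleene e j b (C (e, j, b))" using that(2) by (auto simp: C_def intro: someI)
      ultimately show ?thesis using \<open>t0 \<le> t\<close> by (meson less_le_trans)
    qed
    then show ?thesis unfolding active_def active_lim_def by blast
  qed
  then show thesis by (intro that table_cong) auto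
qed

text \<open>Position \<open>x\<close> lies past all digits of \<open>x\<close>, since
  \<open>x < 3 ^ x\<close>. So this is the scan of \<open>x\<close> against the limit table at every
  stage from \<open>x\<close> on.\<close>

definition scan_lim :: "nat \<Rightarrow> nat \<times> bool" where
  "scan_lim x = scan (table active_lim x) x x"

lemma scan_table_active_lim:
  assumes "x \<le> s"
  shows "scan (table active_lim s) x s = scan_lim x"
proof -
  have "scan (table active_lim s) x s = scan (table active_lim s) x x"
    by (rule scan_beyond[OF _ assms]) (simp add: power_gt_expt)
  also have "\<dots> = scan_lim x"
    unfolding scan_lim_def by (rule scan_cong) (simp_all add: in_table_iff[OF _ assms])
  finally show ?thesis .
qed

lemma infinite_image_scan_lim:
  assumes "infinite A"
  shows "infinite ((fst \<circ> scan_lim) ` A)"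
proof
  assume "finite ((fst \<circ> scan_lim) ` A)"
  then obtain m where m: "\<And>x. x \<in> A \<Longrightarrow> fst (scan_lim x) < m"
    unfolding finite_nat_set_iff_bounded by auto
  have "x \<le> 3 * fst (scan_lim x)" for x
    using le_fst_scan[of x x "table active_lim x"] by (simp add: scan_lim_def power_gt_expt)
  with m have "A \<subseteq> {..3 * m}" by (fastforce intro: order.trans)
  with assms show False using finite_subset by blast
qed

text \<open>Before the turn of index \<open>e\<close> at most \<open>e + 1\<close> segments are claimed at stage \<open>s\<close>. So \<open>e\<close> claims
  one of \<open>e + 2\<close> fixed segments or an earlier one, once \<open>s\<close> is large enough for all earlier wrong
  guesses to be refuted; which one it is may vary with \<open>s\<close>.\<close>

lemma eventually_claimed:
  assumes "infinite A" and A: "\<And>x. x \<in> A \<longleftrightarrow> (\<exists>a. \<forall>b. \<exists>c. kleene e (prod_encode (x, a)) b c)"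
  obtains s0 where "\<And>s. s0 \<le> s \<Longrightarrow>
    \<exists>x\<in>A. x < s \<and> (s, fst (scan_lim x), \<not> snd (scan_lim x)) \<in> set (table active_lim (Suc s))"
proof -
  let ?true = "\<lambda>j. \<forall>b. \<exists>c. kleene e j b c"
  let ?W = "\<lambda>j. fst (scan_lim (fst (prod_decode j)))"
  have "(fst \<circ> scan_lim) ` A \<subseteq> ?W ` Collect ?true"
  proof clarsimp
    fix x assume "x \<in> A"
    then obtain a where "?true (prod_encode (x, a))" using A by blast
    then show "fst (scan_lim x) \<in> ?W ` Collect ?true"
      by (intro image_eqI[of _ _ "prod_encode (x, a)"]) auto
  qed
  then have "infinite (?W ` Collect ?true)"
    using infinite_image_scan_lim[OF \<open>infinite A\<close>] finite_subset by blast
  \<comment> \<open>One segment more than can be claimed before the turn of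
    \<open>e\<close>.\<close>
  then obtain B where B: "finite B" "card B = e + 2" "B \<subseteq> ?W ` Collect ?true"
    using infinite_arbitrarily_large[of _ "e + 2"] by metis
  then obtain F where F: "F \<subseteq> Collect ?true" "finite F" "B = ?W ` F"
    by (meson finite_subset_image)
  then obtain J where J: "\<And>j. j \<in> F \<Longrightarrow> j < J"
    unfolding finite_nat_set_iff_bounded by blast
  \<comment> \<open>For a wrong pair \<open>j\<close>, \<open>b j\<close> is a refutation.\<close>
  define b where "b = (\<lambda>j. SOME b. \<forall>c. \<not> kleene e j b c)"
  have b: "\<not> kleene e j (b j) c" if "\<not> ?true j" for j c
    using that someI_ex[of "\<lambda>b. \<forall>c. \<not> kleene e j b c"] unfolding b_def by auto
  have "finite (b ` {..<J})" by simp
  then obtain m where m: "\<And>j. j < J \<Longrightarrow> b j < m"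
    unfolding finite_nat_set_iff_bounded by auto
  show thesis
  proof (rule that)
    \<comment> \<open>\<open>J\<close> brings all pairs in \<open>F\<close> within the range of the
      search, \<open>m\<close> exposes the refutations of all wrong pairs below \<open>J\<close>,
      and \<open>Suc e\<close> ensures that \<open>e\<close> has a turn at stage
      \<open>s\<close>.\<close>
    fix s assume s: "J + m + Suc e \<le> s"
    let ?T = "table active_lim s"
    let ?L = "claims active_lim s ?T e"
    let ?C = "fst ` {q. (s, q) \<in> set ?L}"
    have scan: "scan ?L (fst (prod_decode j)) s = scan_lim (fst (prod_decode j))" if "j < s" for j
    proof -
      have "fst (prod_decode j) \<le> j"
        by (metis le_prod_encode_1 prod.collapse prod_decode_inverse)
      then show ?thesis using that by (simp add: scan_claims scan_table_active_lim)
    qed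
    have "finite {q. (s, q) \<in> set ?L}"
      by (rule finite_subset[of _ "snd ` set ?L"]) force+
    then have "\<not> B \<subseteq> ?C"
      using card_claimed[of s active_lim e] card_mono[of ?C B] B(2) by auto
    then obtain j where j: "j \<in> F" "?W j \<notin> ?C" using F by blast
    then have "(s, ?W j, r) \<notin> set ?L" for r
      by (metis (mono_tags, lifting) fst_conv image_eqI mem_Collect_eq)
    moreover have "j < s" using J[OF j(1)] s by simp
    moreover have "?true j" using F j by blast
    ultimately have "eligible active_lim s e ?L j"
      by (simp add: eligible_def scan active_lim_def)
    from add_claim_eligible[OF this \<open>j < s\<close>] obtain i where i: "i \<le> j" "eligible active_lim s e ?L i"
      "add_claim active_lim s e ?L =
        (s, fst (scan ?L (fst (prod_decode i)) s), \<not> snd (scan ?L (fst (prod_decode i)) s)) # ?L" .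
    let ?x = "fst (prod_decode i)"
    have "i < s" "i < J" using i \<open>j < s\<close> J[OF j(1)] by simp_all
    \<comment> \<open>The selected \<open>i\<close> may differ from \<open>j\<close>, but it lies
      below \<open>J\<close>, so a wrong \<open>i\<close> would already be refuted.\<close>
    have "?true i"
    proof (rule ccontr)
      assume "\<not> ?true i"
      then have "\<not> kleene e i (b i) c" for c by (rule b)
      moreover have "b i < s" using m[OF \<open>i < J\<close>] s by simp
      ultimately show False using i(2) unfolding eligible_def active_lim_def by blast
    qed
    then have "?true (prod_encode (?x, snd (prod_decode i)))" by simp
    then have "?x \<in> A" using A by blast
    moreover have "?x < s"
      using \<open>i < s\<close> by (metis le_less_trans le_prod_encode_1 prod.collapse prod_decode_inverse)
    moreover have "(s, fst (scan_lim ?x), \<not> snd (scan_lim ?x)) \<in> set (claims active_lim s ?T (Suc e))"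
      using i(3) scan[OF \<open>i < s\<close>] by (simp add: claims_Suc)
    then have "(s, fst (scan_lim ?x), \<not> snd (scan_lim ?x)) \<in> set (table active_lim (Suc s))"
      using set_claims_mono[of "Suc e" s active_lim s ?T] s by (auto simp: table_Suc)
    ultimately show
      "\<exists>x\<in>A. x < s \<and> (s, fst (scan_lim x), \<not> snd (scan_lim x)) \<in> set (table active_lim (Suc s))"
      by blast
  qed
qed

section \<open>The coloring\<close>

text \<open>A digit 1 at \<open>p\<close> forces \<open>3 ^ p \<le> n\<close>, so bounding
  \<open>p\<close> loses nothing and keeps the search computable.\<close>

definition lowest_digit_1 :: "nat \<Rightarrow> bool" where
  "lowest_digit_1 n \<longleftrightarrow> (\<exists>p<Suc n. n mod 3 ^ p = 0 \<and> digit n p = 1)"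

text \<open>The number of digits serves at once as search bound of the approximation, as number of
  stages and as length of the scan.\<close>

definition scan_parity :: "nat \<Rightarrow> bool" where
  "scan_parity n = snd (scan (table (active (num_digits n)) (num_digits n)) n (num_digits n))"

definition coloring :: "nat \<Rightarrow> bool \<times> bool \<times> bool" where
  "coloring n = (lowest_digit_1 n, False, scan_parity n)"

lemma computable_digit [comp_intro]:
  "computable f \<Longrightarrow> computable g \<Longrightarrow> computable (\<lambda>x. digit (f x) (g x))"
  unfolding digit_def by (intro comp_intro)

lemma computable_num_digits: "computable num_digits"
  unfolding num_digits_def
  by (intro comp_intro exI[of "\<lambda>t. n < 3 ^ t" n for n]) (simp add: power_gt_expt)

lemma computable_lowest_digit_1: "computable lowest_digit_1"
  unfolding lowest_digit_1_def by (intro comp_intro)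

lemma computable_scan [comp_intro]:
  assumes "computable f" "computable g" "computable h"
  shows "computable (\<lambda>x. scan (f x) (g x) (h x))"
proof -
  have "computable (\<lambda>x. scan (fst x) (fst (snd x)) (snd (snd x)))"
    unfolding scan_def scan_step_def by (intro comp_intro)
  moreover have "computable (\<lambda>x. (f x, g x, h x))" by (intro comp_intro assms)
  ultimately show ?thesis using computable_compose by fastforce
qed

lemma computable_table: "computable (\<lambda>x. table (active (fst x)) (snd x))"
  unfolding table_def claims_def add_claim_def eligible_def active_def
  by (intro comp_intro) blast

lemma computable_scan_parity: "computable scan_parity"
proof -
  have "computable (\<lambda>n. table (active (num_digits n)) (num_digits n))"
    using computable_compose[OF computable_table, of "\<lambda>n. (num_digits n, num_digits n)"]
      computable_num_digits
    by (simp add: computable_Pair)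
  then show ?thesis
    unfolding scan_parity_def by (intro comp_intro computable_num_digits)
qed

lemma recursive_coloring_coloring: "recursive_coloring coloring"
proof -
  have "computable (\<lambda>n. (if lowest_digit_1 n then 4 else 0) + (if scan_parity n then 1 else 0) :: nat)"
    by (intro comp_intro computable_lowest_digit_1 computable_scan_parity)
  then have "computable (code3 \<circ> coloring)"
    by (simp add: comp_def code3_def coloring_def)
  then show ?thesis
    unfolding recursive_coloring_def recursive_fun_def computable_def by simp
qed

section \<open>Monochromatic sets\<close>

lemma lowest_digit_1_iff:
  assumes "3 ^ m dvd n" "\<not> 3 ^ Suc m dvd n"
  shows "lowest_digit_1 n \<longleftrightarrow> digit n m = 1"
proof
  assume "lowest_digit_1 n"
  then obtain p where p: "3 ^ p dvd n" "digit n p = 1"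
    unfolding lowest_digit_1_def by (auto simp: mod_eq_0_iff_dvd)
  have "\<not> p < m" using p(2) digit_eq_0_of_dvd[OF assms(1)] by auto
  moreover have "\<not> m < p"
    using p(1) assms(2) by (meson Suc_leI dvd_trans le_imp_power_dvd)
  ultimately show "digit n m = 1" using p by (metis linorder_neqE_nat)
next
  assume "digit n m = 1"
  moreover have "m < Suc n"
  proof -
    have "0 < n" using assms(2) by (cases n) auto
    then have "3 ^ m \<le> n" using assms(1) by (simp add: dvd_imp_le)
    then show ?thesis using power_gt_expt[of 3 m] by simp
  qed
  ultimately show "lowest_digit_1 n"
    unfolding lowest_digit_1_def using assms(1) by (auto simp: mod_eq_0_iff_dvd)
qed

text \<open>Modulo 3, \<open>1 + 1\<close> is 2 and \<open>2 + 2\<close> is 1: the lowest nonzero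
  digit keeps its position but changes its value.\<close>

lemma lowest_digit_1_add:
  assumes "3 ^ m dvd x" "3 ^ m dvd y" "\<not> 3 ^ Suc m dvd x" "\<not> 3 ^ Suc m dvd y"
    and "lowest_digit_1 x = lowest_digit_1 y"
  shows "lowest_digit_1 (x + y) \<noteq> lowest_digit_1 x"
proof -
  obtain u v where uv: "x = 3 ^ m * u" "y = 3 ^ m * v" using assms by blast
  then have nd: "\<not> 3 dvd u" "\<not> 3 dvd v" using assms(3,4) by auto
  have d: "digit x m = u mod 3" "digit y m = v mod 3" "digit (x + y) m = (u + v) mod 3"
    by (simp_all add: digit_def uv flip: distrib_left)
  have eq: "u mod 3 = 1 \<longleftrightarrow> v mod 3 = 1"
    using assms(5) lowest_digit_1_iff[OF assms(1,3)] lowest_digit_1_iff[OF assms(2,4)] d by simp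
  have "(u + v) mod 3 \<noteq> 0" "(u + v) mod 3 = 1 \<longleftrightarrow> u mod 3 \<noteq> 1" using nd eq by presburger+
  moreover have "\<not> 3 ^ Suc m dvd x + y"
    using calculation(1) by (auto simp: uv simp flip: distrib_left mod_eq_0_iff_dvd)
  then have "lowest_digit_1 (x + y) \<longleftrightarrow> (u + v) mod 3 = 1"
    using lowest_digit_1_iff[of m "x + y"] assms(1,2) d by simp
  ultimately show ?thesis using lowest_digit_1_iff[OF assms(1,3)] d by simp
qed

text \<open>By \<open>lowest_digit_1_add\<close> no two elements share their lowest position, so
  each further factor 3 discards at most one element.\<close>

lemma infinite_multiples:
  assumes "infinite A" and mono: "\<And>x y. x \<in> A \<Longrightarrow> y \<in> A \<Longrightarrow> x \<noteq> y \<Longrightarrow>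
    lowest_digit_1 x = lowest_digit_1 y \<and> lowest_digit_1 (x + y) = lowest_digit_1 x"
  shows "infinite {y \<in> A. 3 ^ m dvd y}"
proof (induction m)
  case 0
  then show ?case using assms by simp
next
  case (Suc m)
  let ?D = "{y \<in> A. 3 ^ m dvd y \<and> \<not> 3 ^ Suc m dvd y}"
  have "x = y" if "x \<in> ?D" "y \<in> ?D" for x y
    using that mono[of x y] lowest_digit_1_add[of m x y] by blast
  then have "finite ?D" by (metis (no_types, lifting) finite.simps is_singletonI' is_singleton_def)
  moreover have "{y \<in> A. 3 ^ m dvd y} \<subseteq> {y \<in> A. 3 ^ Suc m dvd y} \<union> ?D" by blast
  ultimately show ?case using Suc by (meson finite_UnI finite_subset)
qed

lemma sums_in_FS_le:
  assumes "x \<in> A" "y \<in> A" "z \<in> A" "x \<noteq> y" "x \<noteq> z" "y \<noteq> z"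
  shows "x \<in> FS_le 3 A" "x + y \<in> FS_le 3 A" "x + y + z \<in> FS_le 3 A"
proof -
  show "x \<in> FS_le 3 A"
    unfolding FS_le_def using assms by (intro CollectI exI[of _ "{x}"]) auto
  show "x + y \<in> FS_le 3 A"
    unfolding FS_le_def using assms by (intro CollectI exI[of _ "{x, y}"]) auto
  show "x + y + z \<in> FS_le 3 A"
    unfolding FS_le_def using assms by (intro CollectI exI[of _ "{x, y, z}"]) auto
qed

theorem theorem4p2:
  shows "\<exists>c :: nat \<Rightarrow> bool \<times> bool \<times> bool. recursive_coloring c \<and>
           (\<forall>A. infinite A \<and> Delta03 A \<longrightarrow> \<not> HT_le_solution 3 c A)"
proof (intro exI[of _ coloring] conjI allI impI notI)
  show "recursive_coloring coloring" by (rule recursive_coloring_coloring)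
  fix A assume "infinite A \<and> Delta03 A" and "HT_le_solution 3 coloring A"
  then have inf: "infinite A" and "Sigma03 A"
    and mono: "\<And>m n. m \<in> FS_le 3 A \<Longrightarrow> n \<in> FS_le 3 A \<Longrightarrow> coloring m = coloring n"
    unfolding Delta03_def HT_le_solution_def monochromatic_def by auto
  obtain e where e: "\<And>x. x \<in> A \<longleftrightarrow> (\<exists>a. \<forall>b. \<exists>c. kleene e (prod_encode (x, a)) b c)"
    using Sigma03_kleene[OF \<open>Sigma03 A\<close>] by blast
  obtain s0 where s0: "\<And>s. s0 \<le> s \<Longrightarrow>
    \<exists>x\<in>A. x < s \<and> (s, fst (scan_lim x), \<not> snd (scan_lim x)) \<in> set (table active_lim (Suc s))"
    using eventually_claimed[OF inf e] by blast
  have pair: "x \<in> FS_le 3 A \<and> x + y \<in> FS_le 3 A" if "x \<in> A" "y \<in> A" "x \<noteq> y" for x y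
  proof -
    obtain z where "z \<in> A" "z \<notin> {x, y}" using inf by (meson finite.simps finite_subset subsetI)
    then show ?thesis using that sums_in_FS_le[of x A y z] by auto
  qed
  have mult: "\<exists>y\<in>A. 3 ^ m dvd y \<and> 0 < y" for m
  proof -
    have "lowest_digit_1 x = lowest_digit_1 y \<and> lowest_digit_1 (x + y) = lowest_digit_1 x"
      if "x \<in> A" "y \<in> A" "x \<noteq> y" for x y
      using mono[of x y] mono[of "x + y" x] pair[of x y] pair[of y x] that
      by (simp add: coloring_def)
    from infinite_multiples[OF inf this] have "infinite ({y \<in> A. 3 ^ m dvd y} - {0})" by simp
    then show ?thesis by (metis (no_types, lifting) DiffE bot_nat_0.not_eq_extremum finite.emptyI
          insertCI mem_Collect_eq ex_in_conv)
  qed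
  \<comment> \<open>The order of choice matters: \<open>y\<close> determines \<open>s\<close>, then
    \<open>x\<close> is an element claimed at stage \<open>s\<close>, and \<open>z\<close> comes
    last because \<open>t0\<close> depends on \<open>s\<close>.\<close>
  obtain y where y: "y \<in> A" "3 ^ s0 dvd y" "0 < y" using mult by blast
  obtain s where s: "3 ^ s dvd y" "digit y s \<noteq> 0" using lowest_digit_ex[OF y(3)] .
  have "s0 \<le> s" using s(2) digit_eq_0_of_dvd[OF y(2)] by (meson not_le)
  then obtain x where x: "x \<in> A" "x < s"
    and claim: "(s, fst (scan_lim x), \<not> snd (scan_lim x)) \<in> set (table active_lim (Suc s))"
    using s0 by blast
  have x_less: "x < 3 ^ s" using x(2) power_gt_expt[of 3 s] by simp
  obtain t0 where t0: "\<And>t. t0 \<le> t \<Longrightarrow> table (active t) (Suc s) = table active_lim (Suc s)"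
    using table_active_eventually by blast
  \<comment> \<open>The first summand places \<open>z\<close> above all digits of \<open>y\<close>;
    the second gives \<open>y + z\<close> enough digits for the approximation to be exact through
    stage \<open>s\<close>.\<close>
  let ?m = "num_digits y + t0"
  obtain z where z: "z \<in> A" "3 ^ ?m dvd z" "0 < z" using mult by blast
  have y_less: "y < 3 ^ ?m"
    using less_power_num_digits[of y] by (meson le_add1 less_le_trans one_le_numeral power_increasing)
  have "3 ^ s \<le> y" using s(1) y(3) by (rule dvd_imp_le)
  then have "s < ?m" using y_less
    by (meson le_less_trans one_less_numeral_iff power_less_imp_less_exp semiring_norm(77))
  have "3 ^ ?m \<le> z" using z(2,3) by (rule dvd_imp_le)
  let ?v = "y + z"
  let ?t = "num_digits ?v"
  let ?T = "table (active ?t) ?t"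
  have "?m < ?t"
  proof -
    have "(3::nat) ^ ?m < 3 ^ ?t" using less_power_num_digits[of ?v] \<open>3 ^ ?m \<le> z\<close> by linarith
    then show ?thesis by (simp add: power_strict_increasing_iff)
  qed
  have s_z: "3 ^ Suc s dvd z" using z(2) \<open>s < ?m\<close> by (meson Suc_leI dvd_trans le_imp_power_dvd)
  have v: "3 ^ s dvd ?v" "digit ?v s \<noteq> 0" "0 < ?v"
    using s s_z y digit_add_low[OF s_z, of s y] by (auto intro: dvd_add dvd_trans[OF le_imp_power_dvd])
  \<comment> \<open>The approximated table may be wrong beyond \<open>s\<close>, but there both sums
    are scanned with the same claims anyway.\<close>
  have T: "(p, q) \<in> set ?T \<longleftrightarrow> (p, q) \<in> set (table active_lim (Suc s))" if "p \<le> s" for p q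
    using that in_table_iff[of p "Suc s" ?t q "active ?t"] t0[of ?t] \<open>?m < ?t\<close> \<open>s < ?m\<close> by auto
  have "scan ?T x s = scan (table active_lim s) x s"
    using in_table_iff[of _ s "Suc s" _ active_lim] T by (intro scan_cong) auto
  then have scan: "scan ?T x s = scan_lim x" using x(2) by (simp add: scan_table_active_lim)
  have "snd (scan ?T (x + ?v) ?t) = (\<not> snd (scan ?T ?v ?t))"
  proof (rule scan_add_flip[OF v(1,2) x_less _ _ _ scan])
    show "(s, fst (scan_lim x), \<not> snd (scan_lim x)) \<in> set ?T" using claim T by auto
    then show "(s, fst (scan_lim x), snd (scan_lim x)) \<notin> set ?T"
      using consistent_table[of "active ?t" ?t] unfolding consistent_def by metis
    show "(p, 0, True) \<notin> set ?T" for p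
      using consistent_table[of "active ?t" ?t] unfolding consistent_def by blast
    show "s < ?t" using \<open>s < ?m\<close> \<open>?m < ?t\<close> by simp
  qed
  \<comment> \<open>Both numbers have equally many digits, hence the same table and the same scan
    length.\<close>
  then have "scan_parity (x + ?v) \<noteq> scan_parity ?v"
    unfolding scan_parity_def using num_digits_add[OF v(1,3) x_less] by simp
  moreover have "x + ?v \<in> FS_le 3 A" "?v \<in> FS_le 3 A"
    using sums_in_FS_le[of x A y z] pair[of y z] x(1) y(1) z(1) x_less \<open>3 ^ s \<le> y\<close> y_less \<open>3 ^ ?m \<le> z\<close>
    by (auto simp: add.assoc)
  ultimately show False using mono[of "x + ?v" ?v] by (simp add: coloring_def)
qed

end
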